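(* Let $\mathcal{D}=(V,\mathscr{E})$ be a directed acyclic graph on $V=\{1,\dots,p\}$, and let $\Gamma$ be a partial positive definite matrix in $\mathrm{Q}_{\mathcal{D}}$ that can be completed to a positive definite matrix $\Sigma$ in $\mathrm{PD}_{\mathcal{D}}$. Then: (i) $\displaystyle \Sigma^{-1}=\sum_{i=1}^{p}\left(\left[\left(\Sigma_{\mathrm{fa}(i)}\right)^{-1}\right]^{V}-\left[\left(\Sigma_{\mathrm{pa}(i)}\right)^{-1}\right]^{V}\right)$, and (ii) $\displaystyle \det(\Sigma^{-1})=\frac{\prod_{i=1}^{p}\det(\Sigma_{\mathrm{pa}(i)})}{\prod_{i=1}^{p}\det(\Sigma_{\mathrm{fa}(i)})}=\prod_{i=1}^{p}\left(\Sigma_{ii|\mathrm{pa}(i)}\right)^{-1}$.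
   Context: $\mathcal{D}=(V,\mathscr{E})$ is a directed acyclic graph (DAG: a directed graph with no directed cycles of length greater than 1) on $V=\{1,\dots,p\}$, with vertices numbered so that $i\to j$ (i.e. $(i,j)\in\mathscr{E}$, $i\ne j$) implies $i>j$. By convention edge sets contain all loops. $\mathrm{pa}(j)=\{i\neq j: i\to j\}$, $\mathrm{fa}(j)=\mathrm{pa}(j)\cup\{j\}$, and $\mathrm{pr}(j)=\{i: i>j,\ i\notin \mathrm{pa}(j)\}$. The undirected version of $\mathcal{D}$ is $\mathcal{G}=(V,\mathscr{V})$. A $\mathcal{D}$-partial matrix is a real symmetric function $\Gamma$ on $\{(i,j):\{i,j\}\in\mathscr{V}\}$ (including all diagonal positions), $\Gamma_{ij}=\Gamma_{ji}$. A clique of $\mathcal{D}$ is a maximal set of pairwise adjacent vertices. $\mathrm{Q}_{\mathcal{D}}$ is the set of $\mathcal{D}$-partial matrices $\Gamma$ with $\Gamma_C=(\Gamma_{ij})_{i,j\in C}$ positive definite for every clique $C$ of $\mathcal{D}$. $\Sigma_{A,B}$ is the submatrix with rows in $A$ and columns in $B$; $\Sigma_A=\Sigma_{A,A}$. $\mathrm{PD}_{\mathcal{D}}$ is the set of $p\times p$ matrices $\Sigma\succ 0$ such that $\mathrm{N}_p(0,\Sigma)$ obeys the directed local Markov property with respect to $\mathcal{D}$; equivalently, $\Sigma$ is symmetric positive definite and $\Sigma_{\mathrm{pr}(j),j}=\Sigma_{\mathrm{pr}(j),\mathrm{pa}(j)}(\Sigma_{\mathrm{pa}(j)})^{-1}\Sigma_{\mathrm{pa}(j),j}$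 for all $j\in V$ (right-hand side $0$ if $\mathrm{pa}(j)=\emptyset$). That $\Gamma$ is completed to $\Sigma$ means $\Sigma_{ij}=\Gamma_{ij}$ for each $(i,j)\in\mathscr{E}$ (loops included). For a matrix $M$ indexed by a subset $A\subseteq V$, $[M]^V$ (zero-fill-in) is the $|V|\times|V|$ matrix with $([M]^V)_{ij}=M_{ij}$ if $i,j\in A$ and $0$ otherwise. $\Sigma_{ii|\mathrm{pa}(i)}=\Sigma_{ii}-\Sigma_{i,\mathrm{pa}(i)}(\Sigma_{\mathrm{pa}(i)})^{-1}\Sigma_{\mathrm{pa}(i),i}$ is the Schur complement. When $\mathrm{pa}(i)=\emptyset$: $[(\Sigma_{\mathrm{pa}(i)})^{-1}]^V=0$, $\det(\Sigma_{\mathrm{pa}(i)})=1$, and $\Sigma_{ii|\mathrm{pa}(i)}=\Sigma_{ii}$. *)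

theory Defs
  imports
    "Jordan_Normal_Form.Determinant"
    "Jordan_Normal_Form.Gauss_Jordan_Elimination"
    "Jordan_Normal_Form.DL_Submatrix"
begin

(* Vertices are 0, ..., p - 1, so that they coincide with the row and column indices of a
   p x p matrix; this is the order-preserving relabelling of {1, ..., p}. *)

text \<open>Directed acyclic graphs. Edge sets contain all loops, so acyclicity concerns
  \<open>E - Id\<close>. The numbering convention (edges point from larger to smaller vertices) is included.\<close>

definition dag :: "nat \<Rightarrow> nat rel \<Rightarrow> bool" where
  "dag p E \<longleftrightarrow> E \<subseteq> {..<p} \<times> {..<p} \<and> (\<forall>i<p. (i, i) \<in> E) \<and>
     acyclic (E - Id) \<and> (\<forall>(i, j) \<in> E. i \<noteq> j \<longrightarrow> i > j)"

definition pa :: "nat rel \<Rightarrow> nat \<Rightarrow> nat set" where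
  "pa E j = {i. i \<noteq> j \<and> (i, j) \<in> E}"

definition fa :: "nat rel \<Rightarrow> nat \<Rightarrow> nat set" where
  "fa E j = insert j (pa E j)"

definition pr :: "nat \<Rightarrow> nat rel \<Rightarrow> nat \<Rightarrow> nat set" where
  "pr p E j = {i. i < p \<and> i > j \<and> i \<notin> pa E j}"

definition undirected :: "nat rel \<Rightarrow> nat rel" where
  "undirected E = E \<union> E\<inverse>"

definition complete_set :: "nat \<Rightarrow> nat rel \<Rightarrow> nat set \<Rightarrow> bool" where
  "complete_set p E C \<longleftrightarrow>
     C \<subseteq> {..<p} \<and> (\<forall>i\<in>C. \<forall>j\<in>C. i \<noteq> j \<longrightarrow> (i, j) \<in> undirected E)"

definition clique :: "nat \<Rightarrow> nat rel \<Rightarrow> nat set \<Rightarrow> bool" where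
  "clique p E C \<longleftrightarrow>
     complete_set p E C \<and> (\<forall>C'. complete_set p E C' \<and> C \<subseteq> C' \<longrightarrow> C' = C)"

definition pos_def_mat :: "real mat \<Rightarrow> bool" where
  "pos_def_mat A \<longleftrightarrow> square_mat A \<and> transpose_mat A = A \<and>
     (\<forall>v \<in> carrier_vec (dim_row A). v \<noteq> 0\<^sub>v (dim_row A) \<longrightarrow> v \<bullet> (A *\<^sub>v v) > 0)"

text \<open>Partial matrices are partial functions whose domain is the set of specified positions.\<close>

type_synonym partial_mat = "nat \<times> nat \<rightharpoonup> real"

definition is_partial_mat :: "nat rel \<Rightarrow> partial_mat \<Rightarrow> bool" where
  "is_partial_mat E \<Gamma> \<longleftrightarrow> dom \<Gamma> = undirected E \<and> (\<forall>i j. \<Gamma> (i, j) = \<Gamma> (j, i))"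

definition partial_submatrix :: "partial_mat \<Rightarrow> nat set \<Rightarrow> real mat" where
  "partial_submatrix \<Gamma> C =
     mat (card C) (card C) (\<lambda>(r, c). the (\<Gamma> (pick C r, pick C c)))"

definition Q_DAG :: "nat \<Rightarrow> nat rel \<Rightarrow> partial_mat set" where
  "Q_DAG p E = {\<Gamma>. is_partial_mat E \<Gamma> \<and>
     (\<forall>C. clique p E C \<longrightarrow> pos_def_mat (partial_submatrix \<Gamma> C))}"

text \<open>The following are applied to invertible matrices only. The unique 0 by 0 matrix is its own inverse
  and has determinant 1, which takes care of empty parent sets.\<close>

abbreviation inv_mat :: "real mat \<Rightarrow> real mat" where
  "inv_mat A \<equiv> the (mat_inverse A)"

abbreviation principal_submatrix :: "real mat \<Rightarrow> nat set \<Rightarrow> real mat" where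
  "principal_submatrix \<Sigma> A \<equiv> submatrix \<Sigma> A A"

text \<open>The directed local Markov property of \<open>N\<^sub>p(0, \<Sigma>)\<close>: for each \<open>j\<close>, the \<open>j\<close>-th component is
  independent of the components in \<open>pr(j)\<close> given those in \<open>pa(j)\<close>, expressed through the covariance matrix.
  A product with inner dimension 0 is the zero matrix.\<close>

definition PD_DAG :: "nat \<Rightarrow> nat rel \<Rightarrow> real mat set" where
  "PD_DAG p E = {\<Sigma> \<in> carrier_mat p p. pos_def_mat \<Sigma> \<and>
     (\<forall>j<p. submatrix \<Sigma> (pr p E j) {j} =
        submatrix \<Sigma> (pr p E j) (pa E j) * inv_mat (principal_submatrix \<Sigma> (pa E j))
          * submatrix \<Sigma> (pa E j) {j})}"

definition completed_to :: "nat rel \<Rightarrow> partial_mat \<Rightarrow> real mat \<Rightarrow> bool" where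
  "completed_to E \<Gamma> \<Sigma> \<longleftrightarrow> (\<forall>(i, j) \<in> E. \<Gamma> (i, j) = Some (\<Sigma> $$ (i, j)))"

text \<open>The row or column of \<open>M\<close> belonging to \<open>i \<in> A\<close> is the rank of \<open>i\<close> in \<open>A\<close>, in accordance with
  \<^const>\<open>submatrix\<close>.\<close>

definition zero_fill :: "nat \<Rightarrow> nat set \<Rightarrow> real mat \<Rightarrow> real mat" where
  "zero_fill p A M = mat p p (\<lambda>(i, j).
     if i \<in> A \<and> j \<in> A then M $$ (card {a \<in> A. a < i}, card {a \<in> A. a < j}) else 0)"

definition schur :: "real mat \<Rightarrow> nat \<Rightarrow> nat set \<Rightarrow> real" where
  "schur \<Sigma> i A = \<Sigma> $$ (i, i) -
     (submatrix \<Sigma> {i} A * inv_mat (principal_submatrix \<Sigma> A) * submatrix \<Sigma> A {i}) $$ (0, 0)"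

end

theory Submission
  imports Defs
begin

text \<open>Let \<open>K\<^sub>A\<close> be the zero-fill-in of the inverse of \<open>\<Sigma>\<^sub>A\<close>, let
  \<open>b\<^sub>j = e\<^sub>j - K\<^sub>A \<Sigma> e\<^sub>j\<close> with \<open>A = pa(j)\<close> be the coefficients of the residual of component \<open>j\<close> after
  regression on its parents, and let \<open>s\<^sub>j\<close> be the residual variance, i.e. the Schur complement. The matrix
  \<open>B\<close> with columns \<open>b\<^sub>j\<close> is lower unitriangular because parents have larger numbers. The Markov property
  and the normal equations say that \<open>\<Sigma> b\<^sub>j\<close> vanishes below position \<open>j\<close>, so \<open>B\<^sup>T \<Sigma> B\<close>
  is the diagonal matrix of the \<open>s\<^sub>j\<close>. Hence \<open>\<Sigma>\<close> has determinant \<open>\<Prod> s\<^sub>j\<close>, and its inverse is the sum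
  of the rank one matrices \<open>b\<^sub>j b\<^sub>j\<^sup>T / s\<^sub>j\<close>. Each of these equals
  \<open>K\<^sub>A - K\<^sub>C\<close> with \<open>A = fa(j)\<close>, \<open>C = pa(j)\<close>; comparing entries \<open>(j, j)\<close> and
  using the cofactor formula gives \<open>1 / s\<^sub>j\<close> as a ratio of determinants.\<close>

section \<open>Principal submatrices\<close>

lemma index_mult_mat_sum:
  assumes "A \<in> carrier_mat l m" "B \<in> carrier_mat m n" "i < l" "j < n"
  shows "(A * B) $$ (i, j) = (\<Sum>k<m. A $$ (i, k) * B $$ (k, j))"
  using assms by (simp add: scalar_prod_def lessThan_atLeast0)

text \<open>The inverse map is the rank function, the same one that indexes
  \<open>zero_fill\<close>. This turns sums over matrix positions into sums over vertices.\<close>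

lemma bij_betw_pick:
  assumes "finite A"
  shows "bij_betw (pick A) {..<card A} A"
proof (rule bij_betw_byWitness[where f' = "\<lambda>i. card {a \<in> A. a < i}"])
  show "\<forall>r\<in>{..<card A}. card {a \<in> A. a < pick A r} = r"
    by (simp add: card_pick)
  show "\<forall>i\<in>A. pick A (card {a \<in> A. a < i}) = i"
    by (simp add: pick_card_in_set)
  show "pick A ` {..<card A} \<subseteq> A"
    by (auto intro: pick_in_set)
  show "(\<lambda>i. card {a \<in> A. a < i}) ` A \<subseteq> {..<card A}"
    using assms by (auto intro!: psubset_card_mono)
qed

lemma submatrix_carrier:
  assumes "M \<in> carrier_mat m n" "R \<subseteq> {..<m}" "C \<subseteq> {..<n}"
  shows "submatrix M R C \<in> carrier_mat (card R) (card C)"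
proof -
  have "{i. i < m \<and> i \<in> R} = R" "{j. j < n \<and> j \<in> C} = C"
    using assms by auto
  then show ?thesis
    using assms by (simp add: submatrix_def)
qed

lemma submatrix_pick:
  assumes "M \<in> carrier_mat m n" "R \<subseteq> {..<m}" "C \<subseteq> {..<n}" "r < card R" "c < card C"
  shows "submatrix M R C $$ (r, c) = M $$ (pick R r, pick C c)"
proof -
  have "{i. i < m \<and> i \<in> R} = R" "{j. j < n \<and> j \<in> C} = C"
    using assms by auto
  then show ?thesis
    using assms by (simp add: submatrix_def)
qed

text \<open>Lets block identities, indexed by ranks, be used as identities indexed by
  vertices.\<close>

lemma submatrix_eq_iff:
  assumes M: "M \<in> carrier_mat m n" and N: "N \<in> carrier_mat m n"
    and R: "R \<subseteq> {..<m}" and C: "C \<subseteq> {..<n}"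
  shows "submatrix M R C = submatrix N R C \<longleftrightarrow> (\<forall>i\<in>R. \<forall>j\<in>C. M $$ (i, j) = N $$ (i, j))"
proof
  assume eq: "submatrix M R C = submatrix N R C"
  show "\<forall>i\<in>R. \<forall>j\<in>C. M $$ (i, j) = N $$ (i, j)"
  proof (intro ballI)
    fix i j assume "i \<in> R" "j \<in> C"
    then show "M $$ (i, j) = N $$ (i, j)"
      using submatrix_index_card[of i M j R C] submatrix_index_card[of i N j R C] eq M N R C
      by (auto simp: subset_eq)
  qed
next
  assume "\<forall>i\<in>R. \<forall>j\<in>C. M $$ (i, j) = N $$ (i, j)"
  then show "submatrix M R C = submatrix N R C"
    using submatrix_carrier[OF M R C] submatrix_carrier[OF N R C]
    by (intro eq_matI) (auto simp: submatrix_pick[OF M R C] submatrix_pick[OF N R C] pick_in_set)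
qed

text \<open>The sum over the middle index may be cut down to \<open>A\<close> once the terms outside
  \<open>A\<close> vanish. Asking this of the products covers a left or a right factor supported on
  \<open>A\<close>.\<close>

lemma submatrix_mult:
  assumes X: "X \<in> carrier_mat l m" and Y: "Y \<in> carrier_mat m n"
    and R: "R \<subseteq> {..<l}" and A: "A \<subseteq> {..<m}" and C: "C \<subseteq> {..<n}"
    and zero: "\<And>i j k. i \<in> R \<Longrightarrow> j \<in> C \<Longrightarrow> k < m \<Longrightarrow> k \<notin> A \<Longrightarrow> X $$ (i, k) * Y $$ (k, j) = 0"
  shows "submatrix X R A * submatrix Y A C = submatrix (X * Y) R C"
proof (rule eq_matI)
  have XY: "X * Y \<in> carrier_mat l n"
    using X Y by simp
  note cX = submatrix_carrier[OF X R A] and cY = submatrix_carrier[OF Y A C]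
    and cXY = submatrix_carrier[OF XY R C]
  fix r c
  assume "r < dim_row (submatrix (X * Y) R C)" "c < dim_col (submatrix (X * Y) R C)"
  with cXY have rc: "r < card R" "c < card C" by auto
  let ?i = "pick R r" and ?j = "pick C c"
  have ij: "?i \<in> R" "?j \<in> C" using rc by (auto intro: pick_in_set)
  have "(submatrix X R A * submatrix Y A C) $$ (r, c)
      = (\<Sum>k<card A. X $$ (?i, pick A k) * Y $$ (pick A k, ?j))"
    using rc by (simp add: index_mult_mat_sum[OF cX cY] submatrix_pick[OF X R A] submatrix_pick[OF Y A C])
  also have "\<dots> = (\<Sum>k\<in>A. X $$ (?i, k) * Y $$ (k, ?j))"
    using A finite_subset by (intro sum.reindex_bij_betw bij_betw_pick) auto
  also have "\<dots> = (\<Sum>k<m. X $$ (?i, k) * Y $$ (k, ?j))"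
    using A zero ij by (intro sum.mono_neutral_left) auto
  also have "\<dots> = (X * Y) $$ (?i, ?j)"
    using ij R C by (subst index_mult_mat_sum[OF X Y]) auto
  finally show "(submatrix X R A * submatrix Y A C) $$ (r, c) = submatrix (X * Y) R C $$ (r, c)"
    using rc by (simp add: submatrix_pick[OF XY R C])
qed (use submatrix_carrier[OF X R A] submatrix_carrier[OF Y A C]
    submatrix_carrier[OF mult_carrier_mat[OF X Y] R C] in auto)

lemma submatrix_one:
  assumes "A \<subseteq> {..<p}"
  shows "submatrix (1\<^sub>m p) A A = 1\<^sub>m (card A)"
proof (rule eq_matI)
  have inj: "inj_on (pick A) {..<card A}"
    using bij_betw_pick assms finite_subset by (blast intro: bij_betw_imp_inj_on)
  fix r c assume rc: "r < dim_row (1\<^sub>m (card A))" "c < dim_col (1\<^sub>m (card A))"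
  then have "pick A r \<in> A" "pick A c \<in> A" by (auto intro: pick_in_set)
  moreover from this have "pick A r < p" "pick A c < p" using assms by auto
  ultimately show "submatrix (1\<^sub>m p) A A $$ (r, c) = 1\<^sub>m (card A) $$ (r, c)"
    using rc assms inj by (subst submatrix_pick[of _ p p]) (auto simp: inj_on_eq_iff)
qed (use submatrix_carrier[OF one_carrier_mat assms assms] in auto)

lemma submatrix_zero_fill:
  assumes "M \<in> carrier_mat (card A) (card A)" "A \<subseteq> {..<p}"
  shows "submatrix (zero_fill p A M) A A = M"
proof (rule eq_matI)
  have Z: "zero_fill p A M \<in> carrier_mat p p" by (simp add: zero_fill_def)
  note cZ = submatrix_carrier[OF Z assms(2) assms(2)]
  show "dim_row (submatrix (zero_fill p A M) A A) = dim_row M"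
    "dim_col (submatrix (zero_fill p A M) A A) = dim_col M"
    using cZ assms(1) by auto
  fix r c assume "r < dim_row M" "c < dim_col M"
  then have rc: "r < card A" "c < card A" using assms(1) by auto
  then have "pick A r \<in> A" "pick A c \<in> A" by (auto intro: pick_in_set)
  moreover from this have "pick A r < p" "pick A c < p" using assms(2) by auto
  ultimately show "submatrix (zero_fill p A M) A A $$ (r, c) = M $$ (r, c)"
    unfolding submatrix_pick[OF Z assms(2) assms(2) rc] using rc by (simp add: zero_fill_def card_pick)
qed

section \<open>Inverses and determinants of principal submatrices\<close>

lemma inv_mat:
  fixes A :: "real mat"
  assumes A: "A \<in> carrier_mat n n" and "det A \<noteq> 0"
  shows "A * inv_mat A = 1\<^sub>m n" "inv_mat A * A = 1\<^sub>m n" "inv_mat A \<in> carrier_mat n n"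
proof -
  \<comment> \<open>The result \<open>None\<close> would mean that \<open>A\<close> is not a unit of
    the matrix ring, which a nonzero determinant excludes.\<close>
  obtain B where "mat_inverse A = Some B"
    using det_non_zero_imp_unit[OF assms, of "()"] mat_inverse(1)[OF A, of "()"]
    by (cases "mat_inverse A") auto
  with mat_inverse(2)[OF A this]
  show "A * inv_mat A = 1\<^sub>m n" "inv_mat A * A = 1\<^sub>m n" "inv_mat A \<in> carrier_mat n n"
    by auto
qed

lemma inv_mat_eqI:
  assumes A: "A \<in> carrier_mat n n" and d: "det A \<noteq> 0"
    and X: "X \<in> carrier_mat n n" and AX: "A * X = 1\<^sub>m n"
  shows "inv_mat A = X"
proof -
  have "inv_mat A = inv_mat A * (A * X)"
    using AX inv_mat(3)[OF A d] by simp
  also have "\<dots> = inv_mat A * A * X"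
    by (rule assoc_mult_mat[symmetric, OF inv_mat(3)[OF A d] A X])
  finally show ?thesis
    using inv_mat(2)[OF A d] X by simp
qed

text \<open>The inverse is the adjugate divided by the determinant, and the cofactor at
  \<open>(0, 0)\<close> has sign 1.\<close>

lemma inv_mat_0_0:
  assumes A: "A \<in> carrier_mat n n" and "det A \<noteq> 0" "0 < n"
  shows "inv_mat A $$ (0, 0) = det (mat_delete A 0 0) / det A"
proof -
  have adj: "adj_mat A \<in> carrier_mat n n" "A * adj_mat A = det A \<cdot>\<^sub>m 1\<^sub>m n"
    using adj_mat[OF A] by auto
  have "inv_mat A = inverse (det A) \<cdot>\<^sub>m adj_mat A"
    using assms adj
    by (intro inv_mat_eqI[OF A]) (auto simp: mult_smult_distrib[OF A adj(1)] intro!: eq_matI)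
  then show ?thesis
    using assms adj by (auto simp: adj_mat_def cofactor_def field_simps)
qed

text \<open>A nonzero kernel vector of the submatrix, extended by zeros, would be a nonzero vector
  on which the quadratic form of \<open>S\<close> vanishes.\<close>

lemma det_principal_submatrix_pos_def:
  assumes S: "S \<in> carrier_mat p p" and pd: "pos_def_mat S" and A: "A \<subseteq> {..<p}"
  shows "det (principal_submatrix S A) \<noteq> 0"
proof
  note cA = submatrix_carrier[OF S A A]
  have fin: "finite A" using A finite_subset by blast
  assume "det (principal_submatrix S A) = 0"
  then obtain v where v: "v \<in> carrier_vec (card A)" "v \<noteq> 0\<^sub>v (card A)"
    and ker: "principal_submatrix S A *\<^sub>v v = 0\<^sub>v (card A)"
    using det_0_iff_vec_prod_zero[OF cA] by auto
  \<comment> \<open>The entry of \<open>v\<close> that belongs to vertex \<open>k\<close> sits at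
    the rank of \<open>k\<close> in \<open>A\<close>.\<close>
  define w where "w = vec p (\<lambda>k. if k \<in> A then v $ card {a \<in> A. a < k} else 0)"
  have w: "w \<in> carrier_vec p" by (simp add: w_def)
  have wpick: "w $ pick A r = v $ r" if "r < card A" for r
    using that A pick_in_set[of r A] by (auto simp: w_def card_pick)
  have "w \<noteq> 0\<^sub>v p"
  proof
    assume w0: "w = 0\<^sub>v p"
    have "v = 0\<^sub>v (card A)"
    proof (rule eq_vecI)
      fix r assume r: "r < dim_vec (0\<^sub>v (card A))"
      then have "pick A r < p" using A pick_in_set[of r A] by auto
      with r wpick[of r] w0 show "v $ r = 0\<^sub>v (card A) $ r" by simp
    qed (use v in auto)
    with v show False by simp
  qed
  with pd S w have pos: "w \<bullet> (S *\<^sub>v w) > 0"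
    unfolding pos_def_mat_def by auto
  \<comment> \<open>On \<open>A\<close>, the entries of \<open>S *\<^sub>v w\<close> are those of
    the submatrix applied to \<open>v\<close>. Off \<open>A\<close> they are unknown, but there
    \<open>w\<close> is zero, so every term of the quadratic form vanishes.\<close>
  have Sw: "(S *\<^sub>v w) $ i = 0" if "i \<in> A" for i
  proof -
    obtain r where r: "r < card A" "i = pick A r"
      using bij_betw_pick[OF fin] \<open>i \<in> A\<close> unfolding bij_betw_def by force
    have "(S *\<^sub>v w) $ i = (\<Sum>k<p. S $$ (i, k) * w $ k)"
      using S w that A by (auto simp: scalar_prod_def lessThan_atLeast0)
    also have "\<dots> = (\<Sum>k\<in>A. S $$ (i, k) * w $ k)"
      using A by (intro sum.mono_neutral_right) (auto simp: w_def)
    also have "\<dots> = (\<Sum>c<card A. S $$ (i, pick A c) * w $ pick A c)"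
      by (rule sum.reindex_bij_betw[OF bij_betw_pick[OF fin], symmetric])
    also have "\<dots> = (principal_submatrix S A *\<^sub>v v) $ r"
      using r v cA by (simp add: scalar_prod_def lessThan_atLeast0 wpick submatrix_pick[OF S A A])
    finally show ?thesis using ker r by simp
  qed
  have "w \<bullet> (S *\<^sub>v w) = (\<Sum>i<p. w $ i * (S *\<^sub>v w) $ i)"
    using S by (simp add: scalar_prod_def lessThan_atLeast0)
  also have "\<dots> = 0"
  proof (rule sum.neutral, rule ballI)
    fix i assume "i \<in> {..<p}"
    then show "w $ i * (S *\<^sub>v w) $ i = 0"
      using Sw[of i] by (cases "i \<in> A") (auto simp: w_def)
  qed
  finally show False using pos by simp
qed

lemma pick_insert_least_Suc:
  assumes less: "\<And>a. a \<in> A \<Longrightarrow> i < a" and r: "r < card A"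
  shows "pick (insert i A) (Suc r) = pick A r"
proof -
  have k: "pick A r \<in> A" using r by (simp add: pick_in_set)
  \<comment> \<open>Infinite sets have \<open>card\<close> 0, so \<open>r < card A\<close> forces
    finiteness.\<close>
  have "finite A" using r by (simp add: card_ge_0_finite)
  have "{a \<in> insert i A. a < pick A r} = insert i {a \<in> A. a < pick A r}"
    using less k by auto
  moreover have "i \<notin> {a \<in> A. a < pick A r}" using less by auto
  ultimately have "card {a \<in> insert i A. a < pick A r} = Suc r"
    using r \<open>finite A\<close> by (simp add: card_pick)
  then show ?thesis
    using pick_card_in_set[of "pick A r" "insert i A"] k by (metis insertI2)
qed

text \<open>The least vertex \<open>i\<close> occupies row and column 0, and all other ranks drop by
  one when it is removed.\<close>

lemma mat_delete_principal_submatrix: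
  assumes M: "M \<in> carrier_mat p p" and A: "insert i A \<subseteq> {..<p}"
    and less: "\<And>a. a \<in> A \<Longrightarrow> i < a"
  shows "mat_delete (principal_submatrix M (insert i A)) 0 0 = principal_submatrix M A"
proof -
  have A': "A \<subseteq> {..<p}" using A by auto
  have fin: "finite A" using A' finite_subset by blast
  have "i \<notin> A" using less by blast
  then have card: "card (insert i A) = Suc (card A)" using fin by simp
  show ?thesis
    using submatrix_carrier[OF M A A] submatrix_carrier[OF M A' A'] card
    by (intro eq_matI)
      (auto simp: mat_delete_def submatrix_pick[OF M A A] submatrix_pick[OF M A' A']
        pick_insert_least_Suc[OF less] simp del: pick.simps)
qed

section \<open>Zero-filled inverses\<close>

text \<open>This is \<open>K\<^sub>A\<close> from the overview. At full size, its products with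
  \<open>S\<close> are indexed by vertices instead of ranks.\<close>

definition padded_inv :: "nat \<Rightarrow> real mat \<Rightarrow> nat set \<Rightarrow> real mat" where
  "padded_inv p S A = zero_fill p A (inv_mat (principal_submatrix S A))"

lemma padded_inv_carrier [simp]: "padded_inv p S A \<in> carrier_mat p p"
  by (simp add: padded_inv_def zero_fill_def)

lemma padded_inv_eq_0:
  assumes "i < p" "j < p" "i \<notin> A \<or> j \<notin> A"
  shows "padded_inv p S A $$ (i, j) = 0"
  using assms by (auto simp: padded_inv_def zero_fill_def)

lemma index_mult_eq_0_left:
  assumes "X \<in> carrier_mat l m" "Y \<in> carrier_mat m n" "i < l" "j < n"
    and "\<And>k. k < m \<Longrightarrow> X $$ (i, k) = 0"
  shows "(X * Y) $$ (i, j) = 0"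
  using assms by (subst index_mult_mat_sum) auto

lemma index_mult_eq_0_right:
  assumes "X \<in> carrier_mat l m" "Y \<in> carrier_mat m n" "i < l" "j < n"
    and "\<And>k. k < m \<Longrightarrow> Y $$ (k, j) = 0"
  shows "(X * Y) $$ (i, j) = 0"
  using assms by (subst index_mult_mat_sum) auto

context
  fixes p :: nat and S :: "real mat"
  assumes S [simp]: "S \<in> carrier_mat p p" and pd: "pos_def_mat S"
begin

lemma pos_def_transpose: "S\<^sup>T = S"
  using pd by (simp add: pos_def_mat_def)

text \<open>Since the padded inverse is supported on \<open>A\<close> in both indices, the block
  over \<open>A\<close> of either product only involves the submatrix over \<open>A\<close> and its
  inverse.\<close>

lemma
  assumes A: "A \<subseteq> {..<p}"
  shows mult_padded_inv: "i \<in> A \<Longrightarrow> j \<in> A \<Longrightarrow> (S * padded_inv p S A) $$ (i, j) = of_bool (i = j)"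
    and padded_inv_mult: "i \<in> A \<Longrightarrow> j \<in> A \<Longrightarrow> (padded_inv p S A * S) $$ (i, j) = of_bool (i = j)"
proof -
  let ?K = "padded_inv p S A" and ?SA = "principal_submatrix S A"
  note cA = submatrix_carrier[OF S A A]
  note inv = inv_mat[OF cA det_principal_submatrix_pos_def[OF S pd A]]
  have K: "submatrix ?K A A = inv_mat ?SA"
    unfolding padded_inv_def by (rule submatrix_zero_fill[OF inv(3) A])
  have "submatrix (S * ?K) A A = ?SA * submatrix ?K A A"
    using A by (intro submatrix_mult[symmetric, of _ p p _ p]) (auto simp: padded_inv_eq_0 subset_eq)
  then have 1: "submatrix (S * ?K) A A = submatrix (1\<^sub>m p) A A"
    using K inv(1) by (simp add: submatrix_one[OF A])
  have "submatrix (?K * S) A A = submatrix ?K A A * ?SA"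
    using A by (intro submatrix_mult[symmetric, of _ p p _ p]) (auto simp: padded_inv_eq_0 subset_eq)
  then have 2: "submatrix (?K * S) A A = submatrix (1\<^sub>m p) A A"
    using K inv(2) by (simp add: submatrix_one[OF A])
  have c: "S * ?K \<in> carrier_mat p p" "?K * S \<in> carrier_mat p p"
    using S padded_inv_carrier by (blast intro: mult_carrier_mat)+
  assume ij: "i \<in> A" "j \<in> A"
  then have "i < p" "j < p" using A by auto
  then show "(S * ?K) $$ (i, j) = of_bool (i = j)" "(?K * S) $$ (i, j) = of_bool (i = j)"
    using 1[unfolded submatrix_eq_iff[OF c(1) one_carrier_mat A A]]
      2[unfolded submatrix_eq_iff[OF c(2) one_carrier_mat A A]] ij by auto
qed

text \<open>The usual argument \<open>X = (K * S) * X = K * (S * X) = K\<close> works on the block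
  over \<open>A\<close>, although neither product need be an identity matrix: the supports of
  \<open>K\<close> and \<open>X\<close> hide the other entries.\<close>

lemma padded_inv_unique:
  assumes A: "A \<subseteq> {..<p}" and X: "X \<in> carrier_mat p p"
    and supp: "\<And>i j. i < p \<Longrightarrow> j < p \<Longrightarrow> i \<notin> A \<or> j \<notin> A \<Longrightarrow> X $$ (i, j) = 0"
    and inv: "\<And>i j. i \<in> A \<Longrightarrow> j \<in> A \<Longrightarrow> (S * X) $$ (i, j) = of_bool (i = j)"
  shows "X = padded_inv p S A"
proof (rule eq_matI)
  let ?K = "padded_inv p S A"
  have K: "?K \<in> carrier_mat p p" by simp
  fix i j assume "i < dim_row ?K" "j < dim_col ?K"
  then have ij: "i < p" "j < p" using K by auto
  show "X $$ (i, j) = ?K $$ (i, j)"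
  proof (cases "i \<in> A \<and> j \<in> A")
    case False
    then show ?thesis using ij by (simp add: supp padded_inv_eq_0)
  next
    case True
    have "X $$ (i, j) = (\<Sum>k<p. of_bool (i = k) * X $$ (k, j))"
      using ij by (simp add: of_bool_def if_distrib[of "\<lambda>x. x * _"] cong: if_cong)
    \<comment> \<open>Row \<open>i\<close> of \<open>?K * S\<close> may differ from a unit vector at
      columns outside \<open>A\<close>, but there the rows of \<open>X\<close> are zero.\<close>
    also have "\<dots> = (\<Sum>k<p. (?K * S) $$ (i, k) * X $$ (k, j))"
    proof (rule sum.cong[OF refl])
      fix k assume "k \<in> {..<p}"
      with True ij show "of_bool (i = k) * X $$ (k, j) = (?K * S) $$ (i, k) * X $$ (k, j)"
        using padded_inv_mult[OF A, of i k] supp[of k j] by (cases "k \<in> A") auto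
    qed
    also have "\<dots> = (?K * S * X) $$ (i, j)"
      using ij X by (subst index_mult_mat_sum[of _ p p _ p]) (auto intro: mult_carrier_mat[OF K S])
    also have "\<dots> = (?K * (S * X)) $$ (i, j)"
      using assoc_mult_mat[OF K S X] by simp
    also have "\<dots> = (\<Sum>k<p. ?K $$ (i, k) * (S * X) $$ (k, j))"
      using ij by (intro index_mult_mat_sum[OF K mult_carrier_mat[OF S X]]) auto
    \<comment> \<open>Symmetrically, \<open>S * X\<close> is known only at rows in \<open>A\<close>,
      and the other columns of \<open>?K\<close> are zero.\<close>
    also have "\<dots> = (\<Sum>k<p. ?K $$ (i, k) * of_bool (k = j))"
    proof (rule sum.cong[OF refl])
      fix k assume "k \<in> {..<p}"
      with True ij show "?K $$ (i, k) * (S * X) $$ (k, j) = ?K $$ (i, k) * of_bool (k = j)"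
        using inv[of k j] padded_inv_eq_0[of i p k A S] by (cases "k \<in> A") auto
    qed
    finally show ?thesis
      using ij by (simp add: of_bool_def if_distrib[of "\<lambda>x. _ * x"] cong: if_cong)
  qed
qed (use carrier_matD[OF X] carrier_matD[OF padded_inv_carrier[of p S A]] in auto)

text \<open>By symmetry of \<open>S\<close>, multiplying the transpose by \<open>S\<close> gives the
  transpose of \<open>K * S\<close>. As the support is symmetric too, uniqueness applies.\<close>

lemma padded_inv_sym:
  assumes A: "A \<subseteq> {..<p}"
  shows "(padded_inv p S A)\<^sup>T = padded_inv p S A"
proof (rule padded_inv_unique[OF A])
  let ?K = "padded_inv p S A"
  have K: "?K \<in> carrier_mat p p" by simp
  show "?K\<^sup>T \<in> carrier_mat p p" using K by simp
  show "?K\<^sup>T $$ (i, j) = 0" if "i < p" "j < p" "i \<notin> A \<or> j \<notin> A" for i j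
    using that carrier_matD[OF K] padded_inv_eq_0[of j p i A S] by auto
  show "(S * ?K\<^sup>T) $$ (i, j) = of_bool (i = j)" if "i \<in> A" "j \<in> A" for i j
  proof -
    have "S * ?K\<^sup>T = (?K * S)\<^sup>T"
      using transpose_mult[OF K S] pos_def_transpose by simp
    moreover have "i < p" "j < p" using that A by auto
    then have "(?K * S)\<^sup>T $$ (i, j) = (?K * S) $$ (j, i)"
      using carrier_matD[OF K] carrier_matD[OF S] by (intro index_transpose_mat(1)) auto
    ultimately show ?thesis
      using that padded_inv_mult[OF A, of j i] by auto
  qed
qed

text \<open>The matrix \<open>S * padded_inv p S A * S\<close> collects all regression terms on \<open>A\<close> at once.\<close>

lemma submatrix_regression:
  assumes A: "A \<subseteq> {..<p}" and R: "R \<subseteq> {..<p}" and C: "C \<subseteq> {..<p}"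
  shows "submatrix S R A * inv_mat (principal_submatrix S A) * submatrix S A C
    = submatrix (S * padded_inv p S A * S) R C"
proof -
  let ?K = "padded_inv p S A"
  note inv = inv_mat[OF submatrix_carrier[OF S A A] det_principal_submatrix_pos_def[OF S pd A]]
  have K: "?K \<in> carrier_mat p p" by simp
  have "inv_mat (principal_submatrix S A) = submatrix ?K A A"
    unfolding padded_inv_def by (rule submatrix_zero_fill[OF inv(3) A, symmetric])
  also have "submatrix S R A * \<dots> = submatrix (S * ?K) R A"
    using A by (intro submatrix_mult[OF S K R A A]) (auto simp: padded_inv_eq_0 subset_eq)
  also have "\<dots> * submatrix S A C = submatrix (S * ?K * S) R C"
    using R by (intro submatrix_mult[OF mult_carrier_mat[OF S K] S R A C])
      (auto simp: padded_inv_eq_0 subset_eq simp del: index_mult_mat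
        intro!: index_mult_eq_0_right[OF S K])
  finally show ?thesis .
qed

text \<open>These are the normal equations: for \<open>i \<in> A\<close>, row \<open>i\<close> of
  \<open>S * padded_inv p S A\<close> is a unit vector, so a predictor is reproduced
  exactly.\<close>

lemma regression_on_predictors:
  assumes A: "A \<subseteq> {..<p}" and "i \<in> A" "j < p"
  shows "(S * padded_inv p S A * S) $$ (i, j) = S $$ (i, j)"
proof -
  let ?K = "padded_inv p S A"
  have K: "?K \<in> carrier_mat p p" by simp
  have i: "i < p" using assms by auto
  have "(S * ?K) $$ (i, k) = of_bool (i = k)" if "k < p" for k
  proof (cases "k \<in> A")
    case True
    then show ?thesis using mult_padded_inv[OF A \<open>i \<in> A\<close>] by simp
  next
    case False
    then have "(S * ?K) $$ (i, k) = 0"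
      using that i by (intro index_mult_eq_0_right[OF S K]) (auto simp: padded_inv_eq_0)
    then show ?thesis using False \<open>i \<in> A\<close> by auto
  qed
  then have "(S * ?K * S) $$ (i, j) = (\<Sum>k<p. of_bool (i = k) * S $$ (k, j))"
    using i \<open>j < p\<close> by (subst index_mult_mat_sum[OF mult_carrier_mat[OF S K] S]) auto
  then show ?thesis
    using i by (simp add: of_bool_def if_distrib[of "\<lambda>x. x * _"] cong: if_cong)
qed

lemma schur_eq:
  assumes A: "A \<subseteq> {..<p}" and i: "i < p"
  shows "schur S i A = S $$ (i, i) - (S * padded_inv p S A * S) $$ (i, i)"
proof -
  have K: "padded_inv p S A \<in> carrier_mat p p" by simp
  have "pick {i} 0 = i" by (auto intro: Least_equality)
  moreover have "S * padded_inv p S A * S \<in> carrier_mat p p"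
    by (rule mult_carrier_mat[OF mult_carrier_mat[OF S K] S])
  ultimately have "submatrix (S * padded_inv p S A * S) {i} {i} $$ (0, 0)
      = (S * padded_inv p S A * S) $$ (i, i)"
    using i by (subst submatrix_pick[of _ p p]) (auto simp del: index_mult_mat(1) pick.simps)
  then show ?thesis
    using i submatrix_regression[OF A, of "{i}" "{i}"] by (simp add: schur_def)
qed

end

section \<open>Residuals of the regressions on the parents\<close>

text \<open>Column \<open>j\<close> holds the coefficients of the residual of the \<open>j\<close>-th component after
  regression on its parents.\<close>

definition residual_mat :: "nat \<Rightarrow> nat rel \<Rightarrow> real mat \<Rightarrow> real mat" where
  "residual_mat p E S =
     mat p p (\<lambda>(k, j). of_bool (k = j) - (padded_inv p S (pa E j) * S) $$ (k, j))"

lemma residual_mat_carrier [simp]: "residual_mat p E S \<in> carrier_mat p p"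
  by (simp add: residual_mat_def)

context
  fixes p :: nat and E :: "nat rel" and S :: "real mat"
  assumes dag: "dag p E" and PD: "S \<in> PD_DAG p E"
begin

lemma PD_DAG_carrier: "S \<in> carrier_mat p p" and PD_DAG_pos_def: "pos_def_mat S"
  using PD by (auto simp: PD_DAG_def)

lemma pa_subset: "pa E j \<subseteq> {..<p}" and pa_less: "i \<in> pa E j \<Longrightarrow> j < i"
  using dag by (auto simp: dag_def pa_def)

lemma fa_subset: "j < p \<Longrightarrow> fa E j \<subseteq> {..<p}"
  using pa_subset by (auto simp: fa_def)

text \<open>Rows of the padded inverse outside the parents vanish. As parents have larger numbers,
  this makes the residual matrix lower unitriangular.\<close>

lemma residual_mat_index:
  assumes "k < p" "j < p" "k \<notin> pa E j"
  shows "residual_mat p E S $$ (k, j) = of_bool (k = j)"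
proof -
  have "(padded_inv p S (pa E j) * S) $$ (k, j) = 0"
    using assms by (intro index_mult_eq_0_left[OF padded_inv_carrier PD_DAG_carrier]) (auto simp: padded_inv_eq_0)
  then show ?thesis using assms by (simp add: residual_mat_def)
qed

text \<open>Column \<open>j\<close> of the product holds the covariances of all components with the
  \<open>j\<close>-th residual.\<close>

lemma mult_residual_mat:
  assumes "k < p" "j < p"
  shows "(S * residual_mat p E S) $$ (k, j)
    = S $$ (k, j) - (S * padded_inv p S (pa E j) * S) $$ (k, j)"
proof -
  let ?K = "padded_inv p S (pa E j)"
  have KS: "?K * S \<in> carrier_mat p p" by (rule mult_carrier_mat[OF padded_inv_carrier PD_DAG_carrier])
  have "(S * residual_mat p E S) $$ (k, j)
      = (\<Sum>l<p. S $$ (k, l) * of_bool (l = j)) - (\<Sum>l<p. S $$ (k, l) * (?K * S) $$ (l, j))"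
    using assms
    by (subst index_mult_mat_sum[OF PD_DAG_carrier residual_mat_carrier])
      (auto simp: residual_mat_def right_diff_distrib sum_subtractf simp del: index_mult_mat(1))
  also have "(\<Sum>l<p. S $$ (k, l) * of_bool (l = j)) = S $$ (k, j)"
    using assms by (simp add: of_bool_def if_distrib[of "\<lambda>x. _ * x"] cong: if_cong)
  also have "(\<Sum>l<p. S $$ (k, l) * (?K * S) $$ (l, j)) = (S * (?K * S)) $$ (k, j)"
    by (rule index_mult_mat_sum[OF PD_DAG_carrier KS assms, symmetric])
  also have "S * (?K * S) = S * ?K * S"
    by (rule assoc_mult_mat[symmetric, OF PD_DAG_carrier padded_inv_carrier PD_DAG_carrier])
  finally show ?thesis .
qed

lemma mult_residual_mat_diag:
  assumes "j < p"
  shows "(S * residual_mat p E S) $$ (j, j) = schur S j (pa E j)"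
  using mult_residual_mat[OF assms assms] schur_eq[OF PD_DAG_carrier PD_DAG_pos_def pa_subset assms] by simp

text \<open>The vertices above \<open>j\<close> are its parents and \<open>pr(j)\<close>. The
  residual is uncorrelated with the former by the normal equations and with the latter by the Markov
  property.\<close>

lemma mult_residual_mat_0:
  assumes "j < k" "k < p"
  shows "(S * residual_mat p E S) $$ (k, j) = 0"
proof (cases "k \<in> pa E j")
  case True
  then show ?thesis
    using assms regression_on_predictors[OF PD_DAG_carrier PD_DAG_pos_def pa_subset True, of j] by (simp add: mult_residual_mat)
next
  case False
  have j: "j < p" using assms by simp
  let ?R = "S * padded_inv p S (pa E j) * S"
  have R: "?R \<in> carrier_mat p p"
    by (rule mult_carrier_mat[OF mult_carrier_mat[OF PD_DAG_carrier padded_inv_carrier] PD_DAG_carrier])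
  have pr: "pr p E j \<subseteq> {..<p}" by (auto simp: pr_def)
  \<comment> \<open>The right-hand side of the Markov condition is a block of the full-size
    regression matrix \<open>?R\<close>.\<close>
  have "submatrix S (pr p E j) {j} = submatrix ?R (pr p E j) {j}"
    using PD j submatrix_regression[OF PD_DAG_carrier PD_DAG_pos_def pa_subset pr, of "{j}" j] by (simp add: PD_DAG_def)
  moreover have "k \<in> pr p E j" using assms False by (simp add: pr_def)
  ultimately have "S $$ (k, j) = ?R $$ (k, j)"
    using submatrix_eq_iff[OF PD_DAG_carrier R pr, of "{j}"] j by auto
  then show ?thesis using assms by (simp add: mult_residual_mat del: index_mult_mat)
qed

text \<open>Only the terms with \<open>k \<ge> i\<close> can contribute, and \<open>S * residual_mat p E S\<close> is upper triangular,
  so the product is upper triangular; being symmetric, it is diagonal.\<close>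

lemma residual_mat_congruence:
  "(residual_mat p E S)\<^sup>T * (S * residual_mat p E S)
    = mat p p (\<lambda>(i, j). if i = j then schur S j (pa E j) else 0)" (is "?B\<^sup>T * ?SB = ?D")
proof -
  have B: "?B \<in> carrier_mat p p" "?B\<^sup>T \<in> carrier_mat p p" by auto
  have SB: "?SB \<in> carrier_mat p p" by (rule mult_carrier_mat[OF PD_DAG_carrier B(1)])
  have P: "?B\<^sup>T * ?SB \<in> carrier_mat p p" by (rule mult_carrier_mat[OF B(2) SB])
  have "(?B\<^sup>T * ?SB)\<^sup>T = ?SB\<^sup>T * ?B"
    using transpose_mult[OF B(2) SB] by simp
  also have "?SB\<^sup>T = ?B\<^sup>T * S"
    using transpose_mult[OF PD_DAG_carrier B(1)] pos_def_transpose[OF PD_DAG_carrier PD_DAG_pos_def] by simp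
  also have "?B\<^sup>T * S * ?B = ?B\<^sup>T * ?SB"
    by (rule assoc_mult_mat[OF B(2) PD_DAG_carrier B(1)])
  finally have symP: "(?B\<^sup>T * ?SB)\<^sup>T = ?B\<^sup>T * ?SB" .
  \<comment> \<open>Column \<open>i\<close> of \<open>?B\<close> vanishes at \<open>k < i\<close>,
    and column \<open>j\<close> of \<open>?SB\<close> at \<open>k > j\<close>. With
    \<open>j \<le> i\<close>, a surviving term has \<open>k = i = j\<close>.\<close>
  have summand: "?B\<^sup>T $$ (i, k) * ?SB $$ (k, j) = (if k = i \<and> i = j then schur S j (pa E j) else 0)"
    if "j \<le> i" "i < p" "k < p" for i j k
  proof (cases "k < i")
    case True
    then have "k \<notin> pa E i" using pa_less[of k i] by auto
    then show ?thesis using True that carrier_matD[OF B(1)] residual_mat_index[of k i] by auto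
  next
    case False
    show ?thesis
    proof (cases "k = j")
      case True
      then have "k = i" "i \<notin> pa E i" using False that pa_less[of i i] by auto
      then show ?thesis
        using True that carrier_matD[OF B(1)] residual_mat_index[of i i] mult_residual_mat_diag[of i]
        by auto
    next
      case ne: False
      then have "j < k" using False that by auto
      then show ?thesis using that ne False mult_residual_mat_0[of j k] by auto
    qed
  qed
  have low: "(?B\<^sup>T * ?SB) $$ (i, j) = ?D $$ (i, j)" if "j \<le> i" "i < p" for i j
  proof -
    have "(?B\<^sup>T * ?SB) $$ (i, j) = (\<Sum>k<p. ?B\<^sup>T $$ (i, k) * ?SB $$ (k, j))"
      using that by (intro index_mult_mat_sum[OF B(2) SB]) auto
    also have "\<dots> = (\<Sum>k<p. if k = i \<and> i = j then schur S j (pa E j) else 0)"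
      using that by (intro sum.cong[OF refl] summand) auto
    also have "\<dots> = ?D $$ (i, j)"
      using that by (cases "i = j") auto
    finally show ?thesis .
  qed
  show ?thesis
  proof (rule eq_matI)
    fix i j assume "i < dim_row ?D" "j < dim_col ?D"
    then have ij: "i < p" "j < p" by auto
    show "(?B\<^sup>T * ?SB) $$ (i, j) = ?D $$ (i, j)"
    proof (cases "j \<le> i")
      case True
      then show ?thesis using low ij by blast
    next
      case False
      have "(?B\<^sup>T * ?SB) $$ (i, j) = (?B\<^sup>T * ?SB)\<^sup>T $$ (j, i)"
        using ij carrier_matD[OF P] by (simp del: index_mult_mat transpose_mult)
      also have "\<dots> = ?D $$ (j, i)"
        unfolding symP using low[of i j] False ij by simp
      finally show ?thesis using ij False by auto
    qed
  qed (use P in auto)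
qed

text \<open>By the congruence, the Schur complement is the quadratic form of \<open>S\<close> at
  column \<open>j\<close> of the residual matrix, which is nonzero because its entry
  \<open>j\<close> is 1.\<close>

lemma schur_pos:
  assumes j: "j < p"
  shows "schur S j (pa E j) > 0"
proof -
  let ?B = "residual_mat p E S"
  let ?b = "col ?B j"
  have b: "?b \<in> carrier_vec p" using carrier_matD[OF residual_mat_carrier[of p E S]] by (simp add: carrier_vecI)
  have "?b $ j = 1"
    using j carrier_matD[OF residual_mat_carrier[of p E S]] residual_mat_index[OF j j] pa_less[of j j] by auto
  then have "?b \<noteq> 0\<^sub>v p" using j by auto
  then have "?b \<bullet> (S *\<^sub>v ?b) > 0"
    using PD_DAG_pos_def b PD_DAG_carrier unfolding pos_def_mat_def by auto
  also have "S *\<^sub>v ?b = col (S * ?B) j"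
    using col_mult2[OF PD_DAG_carrier residual_mat_carrier j] by simp
  also have "?b \<bullet> \<dots> = (?B\<^sup>T * (S * ?B)) $$ (j, j)"
    using j PD_DAG_carrier carrier_matD[OF residual_mat_carrier[of p E S]] by (subst index_mult_mat(1)) auto
  finally show ?thesis using j by (simp add: residual_mat_congruence del: index_mult_mat)
qed

section \<open>Determinant and inverse from the residuals\<close>

lemma det_residual_mat: "det (residual_mat p E S) = 1"
proof -
  have "det (residual_mat p E S) = prod_list (diag_mat (residual_mat p E S))"
  proof (rule det_lower_triangular[OF _ residual_mat_carrier])
    fix i j assume "i < j" "j < p"
    then show "residual_mat p E S $$ (i, j) = 0"
      using residual_mat_index[of i j] pa_less[of i j] by auto
  qed
  also have "\<dots> = (\<Prod>i<p. residual_mat p E S $$ (i, i))"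
    using carrier_matD[OF residual_mat_carrier[of p E S]] by (simp add: prod_list_diag_prod lessThan_atLeast0)
  also have "\<dots> = (\<Prod>i<p. 1)"
    using residual_mat_index by (intro prod.cong) (auto simp: pa_def)
  finally show ?thesis by simp
qed

lemma det_S: "det S = (\<Prod>i<p. schur S i (pa E i))"
proof -
  let ?B = "residual_mat p E S" and ?D = "mat p p (\<lambda>(i, j). if i = j then schur S j (pa E j) else 0)"
  have "det S = det (?B\<^sup>T * (S * ?B))"
    using det_mult[of "?B\<^sup>T" p "S * ?B"] det_mult[OF PD_DAG_carrier residual_mat_carrier[of p E S]]
      det_transpose[OF residual_mat_carrier[of p E S]] det_residual_mat
      mult_carrier_mat[OF PD_DAG_carrier residual_mat_carrier[of p E S]] by simp
  also have "\<dots> = prod_list (diag_mat ?D)"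
    unfolding residual_mat_congruence by (rule det_lower_triangular[of p]) auto
  also have "\<dots> = (\<Prod>i<p. schur S i (pa E i))"
    by (simp add: prod_list_diag_prod lessThan_atLeast0)
  finally show ?thesis .
qed

text \<open>This is block inversion when the submatrix over the parents is bordered by the row and
  column of \<open>j\<close>. The right-hand side is recognised as the padded inverse by its support
  and its product with \<open>S\<close>.\<close>

lemma padded_inv_fa:
  assumes j: "j < p" and "a < p" "b < p"
  shows "padded_inv p S (fa E j) $$ (a, b) = padded_inv p S (pa E j) $$ (a, b)
    + residual_mat p E S $$ (a, j) * residual_mat p E S $$ (b, j) / schur S j (pa E j)"
proof -
  let ?K = "padded_inv p S (pa E j)" and ?B = "residual_mat p E S"
  let ?s = "schur S j (pa E j)"
  define X where "X = mat p p (\<lambda>(a, b). ?K $$ (a, b) + ?B $$ (a, j) * ?B $$ (b, j) / ?s)"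
  have K: "?K \<in> carrier_mat p p" by simp
  have X: "X \<in> carrier_mat p p" by (simp add: X_def)
  have s: "?s \<noteq> 0" using schur_pos[OF j] by simp
  have jpa: "j \<notin> pa E j" using pa_less[of j j] by auto
  have X_eq: "X = padded_inv p S (fa E j)"
  proof (rule padded_inv_unique[OF PD_DAG_carrier PD_DAG_pos_def fa_subset[OF j] X])
    fix a b assume ab: "a < p" "b < p" "a \<notin> fa E j \<or> b \<notin> fa E j"
    then have "?K $$ (a, b) = 0" by (intro padded_inv_eq_0) (auto simp: fa_def)
    moreover have "?B $$ (a, j) = 0 \<or> ?B $$ (b, j) = 0"
      using ab j residual_mat_index[of a j] residual_mat_index[of b j] by (auto simp: fa_def)
    ultimately show "X $$ (a, b) = 0" using ab by (auto simp: X_def)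
  next
    fix a b assume ab: "a \<in> fa E j" "b \<in> fa E j"
    then have lt: "a < p" "b < p" using fa_subset[OF j] by auto
    have "(S * X) $$ (a, b) = (\<Sum>k<p. S $$ (a, k) * ?K $$ (k, b))
        + (\<Sum>k<p. S $$ (a, k) * ?B $$ (k, j)) * ?B $$ (b, j) / ?s"
      using lt by (subst index_mult_mat_sum[OF PD_DAG_carrier X])
        (auto simp: X_def distrib_left sum.distrib sum_distrib_right sum_divide_distrib mult.assoc)
    also have "\<dots> = (S * ?K) $$ (a, b) + (S * ?B) $$ (a, j) * ?B $$ (b, j) / ?s"
      using lt j by (simp only: index_mult_mat_sum[OF PD_DAG_carrier K] index_mult_mat_sum[OF PD_DAG_carrier residual_mat_carrier])
    finally have SX: "(S * X) $$ (a, b) = (S * ?K) $$ (a, b) + (S * ?B) $$ (a, j) * ?B $$ (b, j) / ?s" .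
    have b0: "(S * ?K) $$ (a, b) = 0" if "b = j"
      using that lt jpa by (intro index_mult_eq_0_right[OF PD_DAG_carrier K]) (auto simp: padded_inv_eq_0)
    show "(S * X) $$ (a, b) = of_bool (a = b)"
    proof (cases "a = j")
      \<comment> \<open>The rank one term drops out, since the residual of \<open>j\<close> is
        uncorrelated with its parent \<open>a\<close>; the identity block of \<open>S * ?K\<close>
        remains.\<close>
      case False
      then have a: "a \<in> pa E j" using ab by (simp add: fa_def)
      then have "(S * ?B) $$ (a, j) = 0" using pa_less lt by (intro mult_residual_mat_0) auto
      moreover have "(S * ?K) $$ (a, b) = of_bool (a = b)"
        using mult_padded_inv[OF PD_DAG_carrier PD_DAG_pos_def pa_subset a, of b] ab False b0 by (auto simp: fa_def)
      ultimately show ?thesis using SX by simp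
    next
      case True
      \<comment> \<open>The covariance of component \<open>j\<close> with its own residual is
        \<open>?s\<close>, which cancels the divisor.\<close>
      then have SX': "(S * X) $$ (a, b) = (S * ?K) $$ (j, b) + ?B $$ (b, j)"
        using SX mult_residual_mat_diag[OF j] s by simp
      show ?thesis
      proof (cases "b = j")
        case True
        then show ?thesis
          using SX' b0 \<open>a = j\<close> residual_mat_index[OF j j jpa] by simp
      next
        case False
        \<comment> \<open>For \<open>b \<noteq> j\<close> the residual coefficient is minus an entry
          of \<open>?K * S\<close>; transposition shows that it cancels the entry of
          \<open>S * ?K\<close>.\<close>
        have "(S * ?K)\<^sup>T = ?K * S"
          using transpose_mult[OF PD_DAG_carrier K] pos_def_transpose[OF PD_DAG_carrier PD_DAG_pos_def] padded_inv_sym[OF PD_DAG_carrier PD_DAG_pos_def pa_subset] by simp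
        then have "(S * ?K) $$ (j, b) = (?K * S) $$ (b, j)"
          using lt j carrier_matD[OF PD_DAG_carrier] carrier_matD[OF K]
          by (metis index_mult_mat(2,3) index_transpose_mat(1))
        then show ?thesis
          using SX' False \<open>a = j\<close> lt j by (simp add: residual_mat_def del: index_mult_mat)
      qed
    qed
  qed
  then show ?thesis using assms by (simp add: X_def flip: X_eq)
qed

text \<open>Solving \<open>B\<^sup>T * S * B = D\<close> for \<open>S\<close> suggests that its
  inverse is \<open>B\<close> times the inverse of \<open>D\<close> times \<open>B\<^sup>T\<close>,
  which is this sum read entrywise.\<close>

lemma inv_mat_factorization:
  "inv_mat S = mat p p (\<lambda>(a, b).
     \<Sum>j<p. residual_mat p E S $$ (a, j) * residual_mat p E S $$ (b, j) / schur S j (pa E j))"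
    (is "_ = ?X")
proof (rule inv_mat_eqI[OF PD_DAG_carrier])
  let ?B = "residual_mat p E S" and ?s = "\<lambda>j. schur S j (pa E j)"
  let ?D = "mat p p (\<lambda>(i, j). if i = j then ?s j else 0)"
  \<comment> \<open>\<open>C\<close> stands for \<open>?B\<close> times the inverse of
    \<open>?D\<close>, hence \<open>C * ?D = ?B\<close>.\<close>
  define C where "C = mat p p (\<lambda>(a, j). ?B $$ (a, j) / ?s j)"
  have B: "?B \<in> carrier_mat p p" "?B\<^sup>T \<in> carrier_mat p p" by auto
  have C: "C \<in> carrier_mat p p" by (simp add: C_def)
  show X: "?X \<in> carrier_mat p p" by simp
  show "det S \<noteq> 0" using schur_pos by (fastforce simp: det_S)
  have XC: "?X = C * ?B\<^sup>T"
  proof (rule eq_matI)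
    fix a b assume "a < dim_row (C * ?B\<^sup>T)" "b < dim_col (C * ?B\<^sup>T)"
    then have "a < p" "b < p" using C carrier_matD[OF B(1)] by auto
    then show "?X $$ (a, b) = (C * ?B\<^sup>T) $$ (a, b)"
      using carrier_matD[OF B(1)] by (subst index_mult_mat_sum[OF C B(2)]) (auto simp: C_def)
  qed (use C carrier_matD[OF B(1)] in auto)
  have CD: "C * ?D = ?B"
  proof (rule eq_matI)
    fix a b assume "a < dim_row ?B" "b < dim_col ?B"
    then have ab: "a < p" "b < p" using B by auto
    have "(C * ?D) $$ (a, b) = (\<Sum>k<p. C $$ (a, k) * ?D $$ (k, b))"
      using ab by (intro index_mult_mat_sum[OF C]) auto
    also have "\<dots> = (\<Sum>k<p. if k = b then C $$ (a, b) * ?s b else 0)"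
      using ab by (intro sum.cong) auto
    also have "\<dots> = ?B $$ (a, b)"
      using ab schur_pos[of b] by (simp add: C_def)
    finally show "(C * ?D) $$ (a, b) = ?B $$ (a, b)" .
  qed (use carrier_matD[OF C] carrier_matD[OF B(1)] in auto)
  \<comment> \<open>Determinant 1 makes \<open>?B\<close> invertible, so it can be cancelled from
    \<open>?X * S * ?B = ?B\<close>.\<close>
  note BI = inv_mat[OF B(1), unfolded det_residual_mat, OF one_neq_zero]
  have SB: "S * ?B \<in> carrier_mat p p" by (rule mult_carrier_mat[OF PD_DAG_carrier B(1)])
  have XS: "?X * S \<in> carrier_mat p p" by (rule mult_carrier_mat[OF X PD_DAG_carrier])
  have "?X * S * ?B = ?X * (S * ?B)" by (rule assoc_mult_mat[OF X PD_DAG_carrier B(1)])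
  also have "\<dots> = C * (?B\<^sup>T * (S * ?B))"
    unfolding XC by (rule assoc_mult_mat[OF C B(2) SB])
  finally have XSB: "?X * S * ?B = ?B"
    by (simp only: residual_mat_congruence CD)
  have "?X * S = ?X * S * (?B * inv_mat ?B)"
    unfolding BI(1) by (rule right_mult_one_mat[OF XS, symmetric])
  also have "\<dots> = ?X * S * ?B * inv_mat ?B"
    by (rule assoc_mult_mat[symmetric, OF XS B(1) BI(3)])
  finally have "?X * S = 1\<^sub>m p"
    using XSB BI(1) by simp
  then show "S * ?X = 1\<^sub>m p"
    by (rule mat_mult_left_right_inverse[OF X PD_DAG_carrier])
qed

text \<open>At \<open>(j, j)\<close> the padded inverse over the parents is 0 and the residual
  coefficient is 1, so only the reciprocal of the Schur complement is left in the rank one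
  update.\<close>

lemma inverse_schur_eq:
  assumes j: "j < p"
  shows "inverse (schur S j (pa E j))
    = det (principal_submatrix S (pa E j)) / det (principal_submatrix S (fa E j))"
proof -
  have "j \<notin> pa E j" using pa_less[of j j] by auto
  then have "inverse (schur S j (pa E j)) = padded_inv p S (fa E j) $$ (j, j)"
    using padded_inv_fa[OF j j j] residual_mat_index[OF j j] j by (simp add: padded_inv_eq_0 inverse_eq_divide)
  also have "\<dots> = inv_mat (principal_submatrix S (fa E j)) $$ (0, 0)"
  proof -
    \<comment> \<open>All parents exceed \<open>j\<close>, so \<open>j\<close> has rank 0 in its
      family and the corner cofactor applies.\<close>
    have "{a \<in> fa E j. a < j} = {}" using pa_less by (force simp: fa_def)
    then have "card {a \<in> fa E j. a < j} = 0" by (simp only: card.empty)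
    moreover have "j \<in> fa E j" by (simp add: fa_def)
    ultimately show ?thesis using j by (simp add: padded_inv_def zero_fill_def del: card_0_eq)
  qed
  also have "\<dots> = det (mat_delete (principal_submatrix S (fa E j)) 0 0)
      / det (principal_submatrix S (fa E j))"
  proof (rule inv_mat_0_0)
    show "principal_submatrix S (fa E j) \<in> carrier_mat (card (fa E j)) (card (fa E j))"
      using fa_subset[OF j] by (intro submatrix_carrier[OF PD_DAG_carrier])
    show "det (principal_submatrix S (fa E j)) \<noteq> 0"
      by (rule det_principal_submatrix_pos_def[OF PD_DAG_carrier PD_DAG_pos_def fa_subset[OF j]])
    show "0 < card (fa E j)"
      using finite_subset[OF fa_subset[OF j]] by (auto simp: card_gt_0_iff fa_def)
  qed
  also have "mat_delete (principal_submatrix S (fa E j)) 0 0 = principal_submatrix S (pa E j)"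
    unfolding fa_def using fa_subset[OF j] pa_less
    by (intro mat_delete_principal_submatrix[OF PD_DAG_carrier]) (auto simp: fa_def)
  finally show ?thesis .
qed

end

section \<open>Entries of finite sums of matrices\<close>

lemma finsum_mat_carrier:
  fixes M :: "'i \<Rightarrow> 'a::comm_ring_1 mat"
  assumes "\<And>i. i \<in> I \<Longrightarrow> M i \<in> carrier_mat m n"
  shows "finsum (module_mat TYPE('a) m n) M I \<in> carrier_mat m n"
proof -
  interpret abelian_group "module_mat TYPE('a) m n" by (rule abelian_group_mat)
  show ?thesis using finsum_closed[of M I] assms by (auto simp: module_mat_simps)
qed

lemma index_finsum_mat:
  fixes M :: "'i \<Rightarrow> 'a::comm_ring_1 mat"
  assumes "finite I" "\<And>i. i \<in> I \<Longrightarrow> M i \<in> carrier_mat m n" and ab: "a < m" "b < n"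
  shows "finsum (module_mat TYPE('a) m n) M I $$ (a, b) = (\<Sum>i\<in>I. M i $$ (a, b))"
proof -
  interpret abelian_group "module_mat TYPE('a) m n" by (rule abelian_group_mat)
  show ?thesis
    using assms(1,2)
  proof (induction I rule: finite_induct)
    case empty
    then show ?case using ab by (simp add: module_mat_simps)
  next
    case (insert i I)
    then have "finsum (module_mat TYPE('a) m n) M (insert i I)
        = M i + finsum (module_mat TYPE('a) m n) M I"
      by (subst finsum_insert) (auto simp: module_mat_simps)
    \<comment> \<open>The entry of a matrix sum is the sum of entries only within the dimensions of
      the second summand.\<close>
    moreover have "finsum (module_mat TYPE('a) m n) M I \<in> carrier_mat m n"
      using insert.prems by (intro finsum_mat_carrier) auto
    ultimately show ?case using insert ab by auto
  qed
qed

theorem proposition5p1: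
  fixes p :: nat and E :: "nat rel" and \<Gamma> :: partial_mat and \<Sigma> :: "real mat"
  assumes "dag p E"
    and "\<Gamma> \<in> Q_DAG p E"
    and "\<Sigma> \<in> PD_DAG p E"
    and "completed_to E \<Gamma> \<Sigma>"
  shows "inv_mat \<Sigma> =
      (\<Oplus>\<^bsub>module_mat TYPE(real) p p\<^esub> i \<in> {..<p}.
        zero_fill p (fa E i) (inv_mat (principal_submatrix \<Sigma> (fa E i)))
        - zero_fill p (pa E i) (inv_mat (principal_submatrix \<Sigma> (pa E i))))
    \<and> det (inv_mat \<Sigma>) =
      (\<Prod>i<p. det (principal_submatrix \<Sigma> (pa E i))) / (\<Prod>i<p. det (principal_submatrix \<Sigma> (fa E i)))
    \<and> (\<Prod>i<p. det (principal_submatrix \<Sigma> (pa E i))) / (\<Prod>i<p. det (principal_submatrix \<Sigma> (fa E i))) =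
      (\<Prod>i<p. inverse (schur \<Sigma> i (pa E i)))"
proof -
  note dag = assms(1) and PD = assms(3)
  note S = PD_DAG_carrier[OF dag PD]
  let ?M = "\<lambda>i. padded_inv p \<Sigma> (fa E i) - padded_inv p \<Sigma> (pa E i)"
  let ?sum = "finsum (module_mat TYPE(real) p p) ?M {..<p}"
  have M: "?M i \<in> carrier_mat p p" for i by (intro minus_carrier_mat) simp
  have sum_carrier: "?sum \<in> carrier_mat p p" by (rule finsum_mat_carrier) (rule M)
  have inv: "inv_mat \<Sigma> = ?sum"
  proof (rule eq_matI)
    fix a b assume "a < dim_row ?sum" "b < dim_col ?sum"
    then have ab: "a < p" "b < p" using sum_carrier by auto
    have "?sum $$ (a, b) = (\<Sum>i<p. ?M i $$ (a, b))"
      using index_finsum_mat[of "{..<p}" ?M p p a b] M ab by blast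
    \<comment> \<open>Each difference of padded inverses is one rank one term of the factorized
      inverse.\<close>
    also have "\<dots> = (\<Sum>j<p. residual_mat p E \<Sigma> $$ (a, j) * residual_mat p E \<Sigma> $$ (b, j)
        / schur \<Sigma> j (pa E j))"
      using ab carrier_matD[OF padded_inv_carrier]
      by (intro sum.cong) (auto simp: padded_inv_fa[OF dag PD])
    finally show "inv_mat \<Sigma> $$ (a, b) = ?sum $$ (a, b)"
      using ab by (simp add: inv_mat_factorization[OF dag PD])
  qed (use sum_carrier in \<open>auto simp: inv_mat_factorization[OF dag PD]\<close>)
  have ratio: "(\<Prod>i<p. det (principal_submatrix \<Sigma> (pa E i))) / (\<Prod>i<p. det (principal_submatrix \<Sigma> (fa E i)))
      = (\<Prod>i<p. inverse (schur \<Sigma> i (pa E i)))"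
    by (simp add: inverse_schur_eq[OF dag PD] prod_dividef)
  have d: "det \<Sigma> \<noteq> 0" using schur_pos[OF dag PD] by (fastforce simp: det_S[OF dag PD])
  note I = inv_mat[OF S d]
  \<comment> \<open>Multiplicativity gives the reciprocal of \<open>det \<Sigma>\<close>, the
    product of the Schur complements; \<open>ratio\<close> supplies the form with principal
    minors.\<close>
  have "det \<Sigma> * det (inv_mat \<Sigma>) = 1"
    using det_mult[OF S I(3)] I(1) by simp
  then have "det (inv_mat \<Sigma>) = inverse (det \<Sigma>)"
    by (metis inverse_unique)
  then have "det (inv_mat \<Sigma>) = (\<Prod>i<p. inverse (schur \<Sigma> i (pa E i)))"
    by (simp add: det_S[OF dag PD] prod_inversef[symmetric])
  with inv ratio show ?thesis by (simp add: padded_inv_def)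
qed

end
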